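(* One can existentially quantify a set of literals from an SDD circuit in time linear in the circuit size, with the result being a DNNF circuit. That is, there is an algorithm that, given an SDD circuit $\Delta$ and a set of literals $\{\ell_1,\ldots,\ell_n\}$, outputs in time linear in the size of $\Delta$ a DNNF circuit that is logically equivalent to $\exists \ell_1,\ldots,\ell_n\cdot\Delta$.
   Context: An NNF circuit is a Boolean circuit (rooted directed acyclic graph) whose leaves are labelled with constants true/false or literals ($x$ or $\bar{x}$ for a Boolean variable $X$) and whose internal nodes are and-nodes or or-nodes; its size is the size of this graph. An NNF circuit is decomposable if for every and-node the sets of variables of its children are pairwise disjoint. A DNNF circuit is a decomposable NNF circuit. An SDD circuit (sentential decision diagram) is an NNF circuit which is a constant, a literal, or is composed of fragments of the form $(p_1\wedge s_1)\vee\cdots\vee(p_k\wedge s_k)$, where the $p_i$ (primes) and $s_i$ (subs) are again constants, literals or such fragments, such that: the circuit is decomposable (in fact structured decomposable: there is a full binary tree whose leaves are the variables, such that for every conjunction $p_i\wedge s_i$ some tree node has the variables of $p_i$ in its left subtree and those of $s_i$ in its right subtree); and in each fragment the primes form a partition, i.e. each $p_i$ is consistent, $p_i\wedge p_j$ is inconsistent for $i\neq j$, and $p_1\vee\cdots\vee p_k$ is valid. Conditioning: $\varphi|x$ (resp. $\varphi|\bar{x}$) is obtained by replacing every occurrence of variable $X$ in $\varphi$ with true (resp. false). Existential literal quantification is $\exists \ell\cdot\varphi=(\varphi|\ell)\vee(\bar{\ell}\wedge(\varphi|\bar{\ell}))$ (with $\bar{\ell}$ the complement of $\ell$); several literals are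 quantified successively (the order does not matter up to logical equivalence). *)

theory Defs
  imports Main
begin

datatype literal = Pos nat | Neg nat

primrec var :: "literal \<Rightarrow> nat" where
  "var (Pos x) = x"
| "var (Neg x) = x"

primrec compl :: "literal \<Rightarrow> literal" where
  "compl (Pos x) = Neg x"
| "compl (Neg x) = Pos x"

primrec lit_holds :: "(nat \<Rightarrow> bool) \<Rightarrow> literal \<Rightarrow> bool" where
  "lit_holds \<alpha> (Pos x) \<longleftrightarrow> \<alpha> x"
| "lit_holds \<alpha> (Neg x) \<longleftrightarrow> \<not> \<alpha> x"

datatype formula = FConst bool | FLit literal | FAnd "formula list" | FOr "formula list"

fun holds :: "(nat \<Rightarrow> bool) \<Rightarrow> formula \<Rightarrow> bool" where
  "holds \<alpha> (FConst b) \<longleftrightarrow> b"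
| "holds \<alpha> (FLit l) \<longleftrightarrow> lit_holds \<alpha> l"
| "holds \<alpha> (FAnd fs) \<longleftrightarrow> (\<forall>f\<in>set fs. holds \<alpha> f)"
| "holds \<alpha> (FOr fs) \<longleftrightarrow> (\<exists>f\<in>set fs. holds \<alpha> f)"

fun vars :: "formula \<Rightarrow> nat set" where
  "vars (FConst b) = {}"
| "vars (FLit l) = {var l}"
| "vars (FAnd fs) = (\<Union>f\<in>set fs. vars f)"
| "vars (FOr fs) = (\<Union>f\<in>set fs. vars f)"

definition consistent :: "formula \<Rightarrow> bool" where
  "consistent f \<longleftrightarrow> (\<exists>\<alpha>. holds \<alpha> f)"

definition valid :: "formula \<Rightarrow> bool" where
  "valid f \<longleftrightarrow> (\<forall>\<alpha>. holds \<alpha> f)"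

definition equivalent :: "formula \<Rightarrow> formula \<Rightarrow> bool" where
  "equivalent f g \<longleftrightarrow> (\<forall>\<alpha>. holds \<alpha> f \<longleftrightarrow> holds \<alpha> g)"

fun condition :: "formula \<Rightarrow> literal \<Rightarrow> formula" where
  "condition (FConst b) l = FConst b"
| "condition (FLit k) l = (if var k = var l then FConst (k = l) else FLit k)"
| "condition (FAnd fs) l = FAnd (map (\<lambda>f. condition f l) fs)"
| "condition (FOr fs) l = FOr (map (\<lambda>f. condition f l) fs)"

definition exists_lit :: "literal \<Rightarrow> formula \<Rightarrow> formula" where
  "exists_lit l f = FOr [condition f l, FAnd [FLit (compl l), condition f (compl l)]]"

definition exists_lits :: "literal list \<Rightarrow> formula \<Rightarrow> formula" where
  "exists_lits ls f = foldr exists_lit ls f"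

text \<open>Nodes are numbered by their position in the node list and refer to their children by number.
  The numbering is arbitrary; it need not be a topological order.\<close>

datatype node = Const bool | Lit literal | And "nat list" | Or "nat list"

record circuit =
  nodes :: "node list"
  root :: nat

primrec children :: "node \<Rightarrow> nat list" where
  "children (Const b) = []"
| "children (Lit l) = []"
| "children (And js) = js"
| "children (Or js) = js"

definition edges :: "circuit \<Rightarrow> (nat \<times> nat) set" where
  "edges c = {(i, j). i < length (nodes c) \<and> j \<in> set (children (nodes c ! i))}"

text \<open>Only constants and literals may be leaves, hence the non-emptiness condition.\<close>

definition nnf_circuit :: "circuit \<Rightarrow> bool" where
  "nnf_circuit c \<longleftrightarrow>
     root c < length (nodes c) \<and>
     And [] \<notin> set (nodes c) \<and> Or [] \<notin> set (nodes c) \<and>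
     (\<forall>(i, j)\<in>edges c. j < length (nodes c)) \<and>
     acyclic (edges c) \<and>
     (\<forall>i<length (nodes c). (root c, i) \<in> (edges c)\<^sup>*)"

text \<open>The number of nodes plus the number of edges.\<close>

definition circuit_size :: "circuit \<Rightarrow> nat" where
  "circuit_size c = length (nodes c) + (\<Sum>n\<leftarrow>nodes c. length (children n))"

lemma finite_edges: "finite (edges c)"
proof -
  have "edges c = (SIGMA i:{..<length (nodes c)}. set (children (nodes c ! i)))"
    by (auto simp: edges_def)
  then show ?thesis by simp
qed

text \<open>The formula rooted at a node. The guard serves only to make the recursion total.\<close>

function unfold :: "circuit \<Rightarrow> nat \<Rightarrow> formula" where
  "unfold c i =
     (if acyclic (edges c) \<and> i < length (nodes c) then
        (case nodes c ! i of
           Const b \<Rightarrow> FConst b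
         | Lit l \<Rightarrow> FLit l
         | And js \<Rightarrow> FAnd (map (unfold c) js)
         | Or js \<Rightarrow> FOr (map (unfold c) js))
      else undefined)"
  by pat_completeness auto
termination
proof -
  let ?r = "{((c, j), (d, i)). c = d \<and> acyclic (edges c) \<and> (i, j) \<in> edges c}"
  have "wf ?r"
  proof (rule wfI_min)
    fix x :: "circuit \<times> nat" and Q
    assume "x \<in> Q"
    obtain c i where x: "x = (c, i)" by (cases x)
    show "\<exists>z\<in>Q. \<forall>y. (y, z) \<in> ?r \<longrightarrow> y \<notin> Q"
    proof (cases "acyclic (edges c)")
      case True
      then have "wf ((edges c)\<inverse>)"
        by (rule finite_acyclic_wf_converse[OF finite_edges])
      moreover have "i \<in> {i. (c, i) \<in> Q}" using \<open>x \<in> Q\<close> x by simp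
      ultimately obtain z where "z \<in> {i. (c, i) \<in> Q}"
        and "\<And>y. (y, z) \<in> (edges c)\<inverse> \<Longrightarrow> y \<notin> {i. (c, i) \<in> Q}"
        by (rule wfE_min) blast
      then show ?thesis by (intro bexI[of _ "(c, z)"]) auto
    next
      case False
      then show ?thesis using \<open>x \<in> Q\<close> x by (intro bexI[of _ "(c, i)"]) auto
    qed
  qed
  then show ?thesis
    by (relation ?r) (auto simp: edges_def)
qed

declare unfold.simps [simp del]

definition node_vars :: "circuit \<Rightarrow> nat \<Rightarrow> nat set" where
  "node_vars c i = vars (unfold c i)"

definition formula_of :: "circuit \<Rightarrow> formula" where
  "formula_of c = unfold c (root c)"

text \<open>Disjointness is by position in the child list: a child that is listed twice conflicts with
  itself unless it has no variables.\<close>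

definition decomposable :: "circuit \<Rightarrow> bool" where
  "decomposable c \<longleftrightarrow>
     (\<forall>js. And js \<in> set (nodes c) \<longrightarrow>
        (\<forall>a<length js. \<forall>b<length js. a \<noteq> b \<longrightarrow>
           node_vars c (js ! a) \<inter> node_vars c (js ! b) = {}))"

definition dnnf :: "circuit \<Rightarrow> bool" where
  "dnnf c \<longleftrightarrow> nnf_circuit c \<and> decomposable c"

datatype vtree = VLeaf nat | VNode vtree vtree

primrec leaves :: "vtree \<Rightarrow> nat list" where
  "leaves (VLeaf x) = [x]"
| "leaves (VNode l r) = leaves l @ leaves r"

primrec subtrees :: "vtree \<Rightarrow> vtree set" where
  "subtrees (VLeaf x) = {VLeaf x}"
| "subtrees (VNode l r) = insert (VNode l r) (subtrees l \<union> subtrees r)"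

text \<open>The tree may have leaves for variables that do not occur in the circuit.\<close>

definition structured :: "circuit \<Rightarrow> bool" where
  "structured c \<longleftrightarrow>
     (\<exists>T. distinct (leaves T) \<and> vars (formula_of c) \<subseteq> set (leaves T) \<and>
        (\<forall>p s. And [p, s] \<in> set (nodes c) \<longrightarrow>
           (\<exists>l r. VNode l r \<in> subtrees T \<and>
              node_vars c p \<subseteq> set (leaves l) \<and> node_vars c s \<subseteq> set (leaves r))))"

definition partition_primes :: "formula list \<Rightarrow> bool" where
  "partition_primes ps \<longleftrightarrow>
     (\<forall>p\<in>set ps. consistent p) \<and>
     (\<forall>a<length ps. \<forall>b<length ps. a \<noteq> b \<longrightarrow> \<not> consistent (FAnd [ps ! a, ps ! b])) \<and>
     valid (FOr ps)"

text \<open>In a fragment, \<open>es\<close> lists the pairs of a prime and a sub; the prime is the first child of the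
  corresponding and-node.\<close>

inductive sdd_node :: "circuit \<Rightarrow> nat \<Rightarrow> bool" for c where
  const: "nodes c ! i = Const b \<Longrightarrow> sdd_node c i"
| lit: "nodes c ! i = Lit l \<Longrightarrow> sdd_node c i"
| fragment: "nodes c ! i = Or ks \<Longrightarrow>
     map (\<lambda>k. nodes c ! k) ks = map (\<lambda>(p, s). And [p, s]) es \<Longrightarrow>
     (\<And>p s. (p, s) \<in> set es \<Longrightarrow> sdd_node c p \<and> sdd_node c s) \<Longrightarrow>
     partition_primes (map (\<lambda>(p, s). unfold c p) es) \<Longrightarrow>
     sdd_node c i"

definition sdd :: "circuit \<Rightarrow> bool" where
  "sdd c \<longleftrightarrow> nnf_circuit c \<and> decomposable c \<and> structured c \<and> sdd_node c (root c)"

text \<open>A unit-cost RAM in the style of Cook and Reckhow, with registers kept apart from the memory.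
  Subtraction is truncated at zero. A program halts when its program counter leaves the program;
  a halted configuration is not changed by further steps.\<close>

datatype instr =
    LoadConst nat nat
  | Add nat nat nat
  | Sub nat nat nat
  | Load nat nat
  | Store nat nat
  | JumpPos nat nat

type_synonym program = "instr list"

record config =
  pc :: nat
  regs :: "nat \<Rightarrow> nat"
  mem :: "nat \<Rightarrow> nat"

primrec exec :: "instr \<Rightarrow> config \<Rightarrow> config" where
  "exec (LoadConst d k) s = s\<lparr>pc := pc s + 1, regs := (regs s)(d := k)\<rparr>"
| "exec (Add d a b) s = s\<lparr>pc := pc s + 1, regs := (regs s)(d := regs s a + regs s b)\<rparr>"
| "exec (Sub d a b) s = s\<lparr>pc := pc s + 1, regs := (regs s)(d := regs s a - regs s b)\<rparr>"
| "exec (Load d a) s = s\<lparr>pc := pc s + 1, regs := (regs s)(d := mem s (regs s a))\<rparr>"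
| "exec (Store a b) s = s\<lparr>pc := pc s + 1, mem := (mem s)(regs s a := regs s b)\<rparr>"
| "exec (JumpPos a k) s = s\<lparr>pc := (if regs s a > 0 then k else pc s + 1)\<rparr>"

definition halted :: "program \<Rightarrow> config \<Rightarrow> bool" where
  "halted P s \<longleftrightarrow> length P \<le> pc s"

definition step :: "program \<Rightarrow> config \<Rightarrow> config" where
  "step P s = (if halted P s then s else exec (P ! pc s) s)"

text \<open>A circuit is stored as the number of its nodes, its root, and the records of its nodes in
  order of their numbers. The encoding is prefix-free, so a start address determines the circuit.\<close>

primrec lit_code :: "literal \<Rightarrow> nat" where
  "lit_code (Pos x) = 2 * x"
| "lit_code (Neg x) = 2 * x + 1"

primrec encode_node :: "node \<Rightarrow> nat list" where
  "encode_node (Const b) = [0, of_bool b]"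
| "encode_node (Lit l) = [1, lit_code l]"
| "encode_node (And js) = 2 # length js # js"
| "encode_node (Or js) = 3 # length js # js"

definition encode :: "circuit \<Rightarrow> nat list" where
  "encode c = length (nodes c) # root c # concat (map encode_node (nodes c))"

lemma lit_code_inject: "lit_code k = lit_code l \<Longrightarrow> k = l"
  by (cases k; cases l) (simp; presburger)+

lemma encode_node_prefix_free:
  "encode_node m @ xs = encode_node n @ ys \<Longrightarrow> m = n \<and> xs = ys"
  by (cases m; cases n) (auto dest: lit_code_inject simp: of_bool_def split: if_splits)

lemma encode_prefix_free:
  fixes c d :: circuit
  assumes "encode c @ xs = encode d @ ys"
  shows "c = d"
proof -
  have nodes_eq: "ms = ns"
    if "length ms = length ns"
      and "concat (map encode_node ms) @ xs = concat (map encode_node ns) @ ys"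
    for ms ns
    using that by (induction ms ns rule: list_induct2) (auto dest: encode_node_prefix_free)
  have "nodes c = nodes d" "root c = root d"
    using assms by (auto simp: encode_def intro: nodes_eq)
  then show ?thesis by simp
qed

text \<open>Initially the circuit starts at address 0 and is followed by the characteristic table of the
  set of literals, indexed by \<open>lit_code\<close>. Registers 0 and 1 point to the two, all others are 0.\<close>

definition init_mem :: "circuit \<Rightarrow> literal set \<Rightarrow> nat \<Rightarrow> nat" where
  "init_mem c L a =
     (if a < length (encode c) then encode c ! a
      else of_bool (\<exists>l\<in>L. a = length (encode c) + lit_code l))"

definition init_config :: "circuit \<Rightarrow> literal set \<Rightarrow> config" where
  "init_config c L =
     \<lparr>pc = 0, regs = (\<lambda>_. 0)(1 := length (encode c)), mem = init_mem c L\<rparr>"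

text \<open>On halting, register 0 points to the output circuit.\<close>

definition stores_circuit :: "config \<Rightarrow> circuit \<Rightarrow> bool" where
  "stores_circuit s d \<longleftrightarrow> (\<forall>a<length (encode d). mem s (regs s 0 + a) = encode d ! a)"

definition outputs_within :: "program \<Rightarrow> circuit \<Rightarrow> literal set \<Rightarrow> nat \<Rightarrow> circuit \<Rightarrow> bool" where
  "outputs_within P c L t d \<longleftrightarrow>
     (let s = (step P ^^ t) (init_config c L) in halted P s \<and> stores_circuit s d)"

end

theory Submission
  imports Defs
begin

text \<open>Semantically, \<open>\<exists>L\<cdot>f\<close> holds at \<open>\<alpha>\<close> iff \<open>f\<close> holds at some \<open>\<beta>\<close> whose literals are all literals of
  \<open>\<alpha>\<close> or of \<open>L\<close>. This quantifier distributes over disjunctions, and over conjunctions of formulas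
  without common variables because the witnesses \<open>\<beta>\<close> can be glued. On a decomposable circuit it
  therefore acts on the leaves only, where it turns each literal of \<open>L\<close> into true. A constant has a
  code of the same length as a literal, so the machine makes the replacement in place in one
  pass, skipping the child lists.\<close>

section \<open>Semantics of literal quantification\<close>

text \<open>With both literals of a variable in \<open>L\<close>, its value in \<beta> is free; with
  only one, the variable can change only so as to satisfy that literal.\<close>

definition reachable_within :: "literal set \<Rightarrow> (nat \<Rightarrow> bool) \<Rightarrow> (nat \<Rightarrow> bool) \<Rightarrow> bool" where
  "reachable_within L \<alpha> \<beta> \<longleftrightarrow> (\<forall>k. lit_holds \<beta> k \<longrightarrow> lit_holds \<alpha> k \<or> k \<in> L)"

text \<open>\<open>l = Pos (var l)\<close> is the sign of \<open>l\<close>, so the update is the one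
  that satisfies \<open>l\<close>.\<close>

definition set_lit :: "(nat \<Rightarrow> bool) \<Rightarrow> literal \<Rightarrow> nat \<Rightarrow> bool" where
  "set_lit \<alpha> l = \<alpha>(var l := (l = Pos (var l)))"

lemma reachable_within_refl: "reachable_within L \<alpha> \<alpha>"
  by (simp add: reachable_within_def)

lemma reachable_within_empty: "reachable_within {} \<alpha> \<beta> \<longleftrightarrow> \<beta> = \<alpha>"
proof
  assume "reachable_within {} \<alpha> \<beta>"
  then have "lit_holds \<beta> k \<Longrightarrow> lit_holds \<alpha> k" for k by (simp add: reachable_within_def)
  \<comment> \<open>Positive literals transfer the value true from \<beta> to \<alpha>, negative
    ones the value false.\<close>
  from this[of "Pos _"] this[of "Neg _"] show "\<beta> = \<alpha>" by fastforce
qed (simp add: reachable_within_refl)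

lemma lit_holds_compl: "lit_holds \<alpha> (compl l) \<longleftrightarrow> \<not> lit_holds \<alpha> l"
  by (cases l) auto

lemma lit_holds_set_lit:
  "lit_holds (set_lit \<alpha> l) k \<longleftrightarrow> k = l \<or> lit_holds \<alpha> k \<and> k \<noteq> compl l"
  by (cases l; cases k) (auto simp: set_lit_def)

lemma set_lit_idem: "lit_holds \<alpha> l \<Longrightarrow> set_lit \<alpha> l = \<alpha>"
  by (cases l) (auto simp: set_lit_def fun_upd_idem_iff)

lemma holds_condition: "holds \<alpha> (condition f l) \<longleftrightarrow> holds (set_lit \<alpha> l) f"
proof (induction f l rule: condition.induct)
  case (2 k l)
  then show ?case by (cases k; cases l) (auto simp: set_lit_def)
qed auto

text \<open>If \<alpha> satisfies \<open>l\<close>, setting \<open>l\<close> changes nothing and the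
  guard \<open>compl l\<close> refutes the second disjunct; otherwise the second disjunct is
  \<open>f\<close> at \<alpha> itself.\<close>

lemma holds_exists_lit:
  "holds \<alpha> (exists_lit l f) \<longleftrightarrow> holds (set_lit \<alpha> l) f \<or> holds \<alpha> f"
  using set_lit_idem[of \<alpha> l] set_lit_idem[of \<alpha> "compl l"]
  by (cases "lit_holds \<alpha> l") (auto simp: exists_lit_def holds_condition lit_holds_compl)

text \<open>If \<beta> satisfies \<open>l\<close>, then \<open>l\<close> may be set first; otherwise
  \<open>l\<close> is not among the literals of \<beta>, and permitting it changes nothing.\<close>

lemma reachable_within_insert:
  "reachable_within (insert l L) \<alpha> \<beta> \<longleftrightarrow>
     reachable_within L (set_lit \<alpha> l) \<beta> \<or> reachable_within L \<alpha> \<beta>"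
  by (auto simp: reachable_within_def lit_holds_set_lit lit_holds_compl)

lemma holds_exists_lits:
  "holds \<alpha> (exists_lits ls f) \<longleftrightarrow> (\<exists>\<beta>. reachable_within (set ls) \<alpha> \<beta> \<and> holds \<beta> f)"
\<comment> \<open>\<alpha> is generalised since peeling off a quantifier may move it to
  \<open>set_lit \<alpha> l\<close>.\<close>
proof (induction ls arbitrary: \<alpha>)
  case Nil
  then show ?case by (simp add: exists_lits_def reachable_within_empty)
next
  case (Cons l ls)
  have "exists_lits (l # ls) f = exists_lit l (exists_lits ls f)"
    by (simp add: exists_lits_def)
  then show ?case by (auto simp: holds_exists_lit Cons.IH reachable_within_insert)
qed

section \<open>Quantification over leaves and over conjunctions\<close>

lemma ex_reachable_lit:
  "(\<exists>\<beta>. reachable_within L \<alpha> \<beta> \<and> lit_holds \<beta> l) \<longleftrightarrow> l \<in> L \<or> lit_holds \<alpha> l"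
proof
  assume "l \<in> L \<or> lit_holds \<alpha> l"
  \<comment> \<open>\<open>set_lit\<close> makes at most \<open>l\<close> newly true.\<close>
  then have "reachable_within L \<alpha> (set_lit \<alpha> l)"
    by (auto simp: reachable_within_def lit_holds_set_lit)
  then show "\<exists>\<beta>. reachable_within L \<alpha> \<beta> \<and> lit_holds \<beta> l"
    by (auto simp: lit_holds_set_lit)
qed (auto simp: reachable_within_def)

lemma lit_holds_cong: "\<alpha> (var l) = \<beta> (var l) \<Longrightarrow> lit_holds \<alpha> l = lit_holds \<beta> l"
  by (cases l) auto

lemma holds_cong: "(\<And>x. x \<in> vars f \<Longrightarrow> \<alpha> x = \<beta> x) \<Longrightarrow> holds \<alpha> f = holds \<beta> f"
proof (induction \<alpha> f rule: holds.induct)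
  case (2 \<alpha> l)
  then show ?case using lit_holds_cong[of \<alpha> l \<beta>] by simp
next
  case (3 \<alpha> fs)
  have "holds \<alpha> f = holds \<beta> f" if "f \<in> set fs" for f
    by (rule "3.IH"[OF that]) (use "3.prems" that in auto)
  then show ?case by simp
next
  case (4 \<alpha> fs)
  have "holds \<alpha> f = holds \<beta> f" if "f \<in> set fs" for f
    by (rule "4.IH"[OF that]) (use "4.prems" that in auto)
  then show ?case by simp
qed auto

text \<open>Reachability constrains each variable separately, so witnesses for formulas without
  common variables combine variable by variable.\<close>

lemma ex_reachable_conj:
  assumes disj: "\<And>a b. a < length fs \<Longrightarrow> b < length fs \<Longrightarrow> a \<noteq> b \<Longrightarrow> vars (fs ! a) \<inter> vars (fs ! b) = {}"
    and ex: "\<And>f. f \<in> set fs \<Longrightarrow> \<exists>\<beta>. reachable_within L \<alpha> \<beta> \<and> holds \<beta> f"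
  shows "\<exists>\<beta>. reachable_within L \<alpha> \<beta> \<and> (\<forall>f\<in>set fs. holds \<beta> f)"
proof -
  obtain B where B: "\<And>f. f \<in> set fs \<Longrightarrow> reachable_within L \<alpha> (B f) \<and> holds (B f) f"
    using ex by metis
  \<comment> \<open>Variables outside all the formulas keep their value in \<alpha>, which is always
    permitted.\<close>
  define \<beta> where "\<beta> x = (if \<exists>f\<in>set fs. x \<in> vars f
    then B (SOME f. f \<in> set fs \<and> x \<in> vars f) x else \<alpha> x)" for x
  \<comment> \<open>This determines the formula chosen by \<open>SOME\<close>.\<close>
  have unique: "f = g" if "f \<in> set fs" "g \<in> set fs" "x \<in> vars f" "x \<in> vars g" for f g x
    using that disj by (auto simp: in_set_conv_nth disjoint_iff)
  have \<beta>_eq: "\<beta> x = B f x" if "f \<in> set fs" "x \<in> vars f" for f x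
  proof -
    have "(SOME g. g \<in> set fs \<and> x \<in> vars g) = f"
      using that unique by (intro some_equality) blast+
    then show ?thesis using that by (auto simp: \<beta>_def)
  qed
  have "lit_holds \<alpha> k \<or> k \<in> L" if "lit_holds \<beta> k" for k
  proof (cases "\<exists>f\<in>set fs. var k \<in> vars f")
    case True
    then obtain f where f: "f \<in> set fs" "var k \<in> vars f" by blast
    then have "lit_holds (B f) k" using that \<beta>_eq lit_holds_cong by metis
    then show ?thesis using B[OF f(1)] by (simp add: reachable_within_def)
  next
    case False
    then have "\<beta> (var k) = \<alpha> (var k)" by (simp add: \<beta>_def)
    then show ?thesis using that lit_holds_cong by metis
  qed
  moreover have "holds \<beta> f" if "f \<in> set fs" for f
    using B[OF that] holds_cong[of f \<beta> "B f"] \<beta>_eq[OF that] by simp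
  ultimately show ?thesis unfolding reachable_within_def by blast
qed

section \<open>Forgetting literals in a circuit\<close>

fun forget_node :: "literal set \<Rightarrow> node \<Rightarrow> node" where
  "forget_node L (Lit l) = (if l \<in> L then Const True else Lit l)"
| "forget_node L n = n"

definition forget :: "literal set \<Rightarrow> circuit \<Rightarrow> circuit" where
  "forget L c = c\<lparr>nodes := map (forget_node L) (nodes c)\<rparr>"

lemma children_forget_node [simp]: "children (forget_node L n) = children n"
  by (cases n) auto

lemma forget_node_eq_And [simp]: "forget_node L n = And js \<longleftrightarrow> n = And js"
  by (cases n) auto

lemma forget_node_eq_Or [simp]: "forget_node L n = Or js \<longleftrightarrow> n = Or js"
  by (cases n) auto

lemma length_nodes_forget [simp]: "length (nodes (forget L c)) = length (nodes c)"
  by (simp add: forget_def)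

lemma nth_nodes_forget:
  "i < length (nodes c) \<Longrightarrow> nodes (forget L c) ! i = forget_node L (nodes c ! i)"
  by (simp add: forget_def)

lemma root_forget [simp]: "root (forget L c) = root c"
  by (simp add: forget_def)

lemma edges_forget [simp]: "edges (forget L c) = edges c"
  by (auto simp: edges_def nth_nodes_forget)

lemma And_in_forget [simp]: "And js \<in> set (nodes (forget L c)) \<longleftrightarrow> And js \<in> set (nodes c)"
  by (auto simp: forget_def image_iff eq_commute[of "And _"])

lemma Or_in_forget [simp]: "Or js \<in> set (nodes (forget L c)) \<longleftrightarrow> Or js \<in> set (nodes c)"
  by (auto simp: forget_def image_iff eq_commute[of "Or _"])

lemma nnf_circuit_forget: "nnf_circuit c \<Longrightarrow> nnf_circuit (forget L c)"
  by (simp add: nnf_circuit_def)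

section \<open>Induction over nodes and correctness of forgetting\<close>

lemma child_less_length:
  "nnf_circuit c \<Longrightarrow> i < length (nodes c) \<Longrightarrow> j \<in> set (children (nodes c ! i)) \<Longrightarrow>
    j < length (nodes c)"
  unfolding nnf_circuit_def edges_def by blast

text \<open>Node numbers need not be in topological order, so the induction runs along the edges,
  well-founded because finite and acyclic.\<close>

lemma nnf_circuit_induct [consumes 2, case_names node]:
  assumes "nnf_circuit c" "i < length (nodes c)"
    and step: "\<And>i. i < length (nodes c) \<Longrightarrow>
      (\<And>j. j \<in> set (children (nodes c ! i)) \<Longrightarrow> P j) \<Longrightarrow> P i"
  shows "P i"
proof -
  have "wf ((edges c)\<inverse>)"
    using assms(1) finite_edges by (auto simp: nnf_circuit_def intro: finite_acyclic_wf_converse)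
  then show ?thesis using assms(2)
  proof (induction i rule: wf_induct_rule)
    case (less i)
    show ?case
      using less.prems
    proof (rule step)
      fix j assume "j \<in> set (children (nodes c ! i))"
      then show "P j"
        using less child_less_length[OF assms(1)] by (auto simp: edges_def)
    qed
  qed
qed

lemma unfold_nnf:
  "nnf_circuit c \<Longrightarrow> i < length (nodes c) \<Longrightarrow> unfold c i =
    (case nodes c ! i of
       Const b \<Rightarrow> FConst b
     | Lit l \<Rightarrow> FLit l
     | And js \<Rightarrow> FAnd (map (unfold c) js)
     | Or js \<Rightarrow> FOr (map (unfold c) js))"
  by (subst unfold.simps) (simp add: nnf_circuit_def)

text \<open>Replaced literals lose their variables, hence only an inclusion; it keeps disjoint
  variable sets disjoint and so preserves decomposability.\<close>

lemma node_vars_forget: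
  assumes "nnf_circuit c" "i < length (nodes c)"
  shows "node_vars (forget L c) i \<subseteq> node_vars c i"
  using assms
proof (induction i rule: nnf_circuit_induct)
  case (node i)
  then show ?case
    by (cases "nodes c ! i") (auto simp: node_vars_def nth_nodes_forget
      unfold_nnf[OF assms(1)] unfold_nnf[OF nnf_circuit_forget[OF assms(1)]])
qed

lemma dnnf_forget:
  assumes "dnnf c"
  shows "dnnf (forget L c)"
proof -
  have nnf: "nnf_circuit c" and dec: "decomposable c" using assms by (auto simp: dnnf_def)
  have "node_vars (forget L c) (js ! a) \<inter> node_vars (forget L c) (js ! b) = {}"
    if js: "And js \<in> set (nodes c)" and ab: "a < length js" "b < length js" "a \<noteq> b" for js a b
  proof -
    obtain i where i: "i < length (nodes c)" "nodes c ! i = And js"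
      using js by (auto simp: in_set_conv_nth)
    have "js ! a < length (nodes c)" "js ! b < length (nodes c)"
      using child_less_length[OF nnf i(1)] i(2) ab by auto
    moreover have "node_vars c (js ! a) \<inter> node_vars c (js ! b) = {}"
      using dec js ab unfolding decomposable_def by blast
    ultimately show ?thesis using node_vars_forget[OF nnf] by blast
  qed
  then show ?thesis
    using nnf_circuit_forget[OF nnf] by (simp add: dnnf_def decomposable_def)
qed

lemma holds_unfold_forget:
  assumes "dnnf c" "i < length (nodes c)"
  shows "holds \<alpha> (unfold (forget L c) i) \<longleftrightarrow>
    (\<exists>\<beta>. reachable_within L \<alpha> \<beta> \<and> holds \<beta> (unfold c i))"
proof -
  have nnf: "nnf_circuit c" and dec: "decomposable c" using assms by (auto simp: dnnf_def)
  note unfolds = unfold_nnf[OF nnf] unfold_nnf[OF nnf_circuit_forget[OF nnf]] nth_nodes_forget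
  show ?thesis
    using nnf assms(2)
  proof (induction i rule: nnf_circuit_induct)
    case (node i)
    show ?case
    proof (cases "nodes c ! i")
      case (Const b)
      then show ?thesis
        using node.hyps reachable_within_refl by (auto simp: unfolds)
    next
      case (Lit l)
      then show ?thesis
        using node.hyps by (simp add: unfolds ex_reachable_lit)
    next
      case (And js)
      have "And js \<in> set (nodes c)" using And node.hyps nth_mem by metis
      then have "vars (map (unfold c) js ! a) \<inter> vars (map (unfold c) js ! b) = {}"
        if "a < length js" "b < length js" "a \<noteq> b" for a b
        using dec that by (simp add: decomposable_def node_vars_def)
      \<comment> \<open>From left to right the witnesses are glued; the converse is
        immediate.\<close>
      then have "(\<forall>f\<in>set (map (unfold c) js). \<exists>\<beta>. reachable_within L \<alpha> \<beta> \<and> holds \<beta> f) \<longleftrightarrow>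
          (\<exists>\<beta>. reachable_within L \<alpha> \<beta> \<and> (\<forall>f\<in>set (map (unfold c) js). holds \<beta> f))"
        using ex_reachable_conj[of "map (unfold c) js" L \<alpha>] by fastforce
      then show ?thesis
        using node And by (simp add: unfolds)
    next
      case (Or js)
      then show ?thesis
        using node by (auto simp: unfolds)
    qed
  qed
qed

lemma equivalent_forget:
  assumes "dnnf c"
  shows "equivalent (formula_of (forget (set ls) c)) (exists_lits ls (formula_of c))"
  using assms holds_unfold_forget[OF assms]
  by (simp add: equivalent_def formula_of_def holds_exists_lits dnnf_def nnf_circuit_def)

section \<open>The machine program\<close>

text \<open>Register 2 holds 1, so that \<open>JumpPos 2\<close> is unconditional. Register 3 counts the remaining
  nodes, 4 is the read pointer, 5 and 6 receive the first two words of the current record, and 7 is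
  scratch. The loop head is at 3; at 14 the table is consulted for a literal, and at 18 its record is
  overwritten by the code \<open>[0, 1]\<close> of true, second word first.\<close>

definition forget_program :: program where
  "forget_program =
    [LoadConst 2 1, Load 3 0, LoadConst 4 2,
     JumpPos 3 5, JumpPos 2 25,
     Sub 3 3 2, Load 5 4, Add 4 4 2, Load 6 4, Add 4 4 2,
     JumpPos 5 12, JumpPos 2 3,
     Sub 5 5 2, JumpPos 5 23,
     Add 7 1 6, Load 7 7, JumpPos 7 18, JumpPos 2 3,
     Sub 7 4 2, Store 7 2, Sub 7 7 2, Store 7 0, JumpPos 2 3,
     Add 4 4 6, JumpPos 2 3]"

section \<open>Symbolic execution and memory contents\<close>

lemma forget_program_step:
  "pc s < 25 \<Longrightarrow> step forget_program s = exec (forget_program ! pc s) s"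
  by (simp add: step_def halted_def forget_program_def)

lemma forget_program_nth:
  "forget_program ! 0 = LoadConst 2 1" "forget_program ! 1 = Load 3 0"
  "forget_program ! 2 = LoadConst 4 2" "forget_program ! 3 = JumpPos 3 5"
  "forget_program ! 4 = JumpPos 2 25" "forget_program ! 5 = Sub 3 3 2"
  "forget_program ! 6 = Load 5 4" "forget_program ! 7 = Add 4 4 2"
  "forget_program ! 8 = Load 6 4" "forget_program ! 9 = Add 4 4 2"
  "forget_program ! 10 = JumpPos 5 12" "forget_program ! 11 = JumpPos 2 3"
  "forget_program ! 12 = Sub 5 5 2" "forget_program ! 13 = JumpPos 5 23"
  "forget_program ! 14 = Add 7 1 6" "forget_program ! 15 = Load 7 7"
  "forget_program ! 16 = JumpPos 7 18" "forget_program ! 17 = JumpPos 2 3"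
  "forget_program ! 18 = Sub 7 4 2" "forget_program ! 19 = Store 7 2"
  "forget_program ! 20 = Sub 7 7 2" "forget_program ! 21 = Store 7 0"
  "forget_program ! 22 = JumpPos 2 3" "forget_program ! 23 = Add 4 4 6"
  "forget_program ! 24 = JumpPos 2 3"
  by (simp_all add: forget_program_def)

text \<open>Peels off the first step, so that the simplifier runs the machine forwards from a known
  configuration. The case 1 ends the unrolling; deleting \<open>One_nat_def\<close> in later calls
  keeps 1 in this form.\<close>

lemma funpow_expand:
  "(f ^^ numeral k) x = (f ^^ pred_numeral k) (f x)"
  "(f ^^ 1) x = f x"
  by (simp_all add: numeral_eq_Suc funpow_Suc_right del: funpow.simps(2))

text \<open>Separates the circuit code \<open>xs\<close>, which is rewritten, from the rest
  \<open>T\<close>, which holds the literal table and never changes.\<close>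

definition list_mem :: "nat list \<Rightarrow> (nat \<Rightarrow> nat) \<Rightarrow> nat \<Rightarrow> nat" where
  "list_mem xs T a = (if a < length xs then xs ! a else T a)"

lemma list_mem_append:
  "list_mem (xs @ y # ys) T (length xs) = y"
  "list_mem (xs @ y # z # ys) T (length xs + 1) = z"
  by (simp_all add: list_mem_def nth_append)

lemma list_mem_update:
  "(list_mem (xs @ y # ys) T)(length xs := y') = list_mem (xs @ y' # ys) T"
  "(list_mem (xs @ y # z # ys) T)(length xs + 1 := z') = list_mem (xs @ y # z' # ys) T"
proof -
  show eq: "(list_mem (xs @ y # ys) T)(length xs := y') = list_mem (xs @ y' # ys) T"
    for xs y ys y'
    by (auto simp: fun_eq_iff list_mem_def nth_append nth_Cons')
  show "(list_mem (xs @ y # z # ys) T)(length xs + 1 := z') = list_mem (xs @ y # z' # ys) T"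
    using eq[of "xs @ [y]" z ys z'] by simp
qed

section \<open>The loop and its invariant\<close>

definition lit_table :: "nat \<Rightarrow> literal set \<Rightarrow> nat \<Rightarrow> nat" where
  "lit_table b L a = of_bool (\<exists>l\<in>L. a = b + lit_code l)"

lemma lit_table_lit_code: "lit_table b L (b + lit_code l) = of_bool (l \<in> L)"
  by (auto simp: lit_table_def dest: lit_code_inject)

text \<open>Invariant at the loop head: table base \<open>b\<close>, \<open>k\<close> nodes
  remaining, read pointer \<open>p\<close>. Registers 5 to 7 are left free because each pass writes
  them before reading them.\<close>

definition loop_state :: "nat \<Rightarrow> nat \<Rightarrow> nat \<Rightarrow> nat list \<Rightarrow> (nat \<Rightarrow> nat) \<Rightarrow> config \<Rightarrow> bool" where
  "loop_state b k p xs T s \<longleftrightarrow> pc s = 3 \<and> regs s 0 = 0 \<and> regs s 1 = b \<and> regs s 2 = 1 \<and>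
     regs s 3 = k \<and> regs s 4 = p \<and> mem s = list_mem xs T"

text \<open>A child list is skipped by one addition, so the bound does not depend on its length. The
  witnesses count the instructions on each path; the longest, for a literal of \<open>L\<close>, has
  17.\<close>

lemma loop_body:
  assumes s: "loop_state b (Suc k) (length xs) (xs @ encode_node n @ ys) (lit_table b L) s"
    and b: "b = length (xs @ encode_node n @ ys)"
  shows "\<exists>t\<le>20. loop_state b k (length xs + length (encode_node n))
    (xs @ encode_node (forget_node L n) @ ys) (lit_table b L) ((step forget_program ^^ t) s)"
proof -
  obtain r where s_eq: "s = \<lparr>pc = 3, regs = r, mem = list_mem (xs @ encode_node n @ ys) (lit_table b L)\<rparr>"
    and r: "r 0 = 0" "r 1 = b" "r 2 = 1" "r 3 = Suc k" "r 4 = length xs"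
    using s by (cases s) (auto simp: loop_state_def)
  note run = s_eq r forget_program_step forget_program_nth loop_state_def list_mem_append
    funpow_expand
  show ?thesis
  proof (cases n)
    case (Const c)
    show ?thesis
      by (intro exI[of _ 8]) (simp add: run Const del: One_nat_def)
  next
    case (Lit l)
    show ?thesis
    proof (cases "l \<in> L")
      case True
      \<comment> \<open>Since \<open>b\<close> is the length of the code, this address falls into
        the table.\<close>
      have "list_mem (xs @ encode_node n @ ys) (lit_table b L) (b + lit_code l) = 1"
        using True lit_table_lit_code[of b L l] by (simp add: list_mem_def b)
      then show ?thesis
        using True by (intro exI[of _ 17]) (simp add: run Lit list_mem_update del: One_nat_def)
    next
      case False
      have "list_mem (xs @ encode_node n @ ys) (lit_table b L) (b + lit_code l) = 0"
        using False lit_table_lit_code[of b L l] by (simp add: list_mem_def b)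
      then show ?thesis
        using False by (intro exI[of _ 13]) (simp add: run Lit del: One_nat_def)
    qed
  next
    case (And js)
    show ?thesis
      by (intro exI[of _ 11]) (simp add: run And del: One_nat_def)
  next
    case (Or js)
    show ?thesis
      by (intro exI[of _ 11]) (simp add: run Or del: One_nat_def)
  qed
qed

lemma loop:
  assumes "loop_state b (length ns) (length xs) (xs @ concat (map encode_node ns)) (lit_table b L) s"
    and "b = length (xs @ concat (map encode_node ns))"
  shows "\<exists>t\<le>20 * length ns. \<exists>p. loop_state b 0 p
    (xs @ concat (map encode_node (map (forget_node L) ns))) (lit_table b L)
    ((step forget_program ^^ t) s)"
  using assms
proof (induction ns arbitrary: xs s)
  case Nil
  then show ?case by auto
next
  case (Cons n ns)
  \<comment> \<open>Equal lengths keep the table base and the later records in place.\<close>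
  have len: "length (encode_node (forget_node L n)) = length (encode_node n)"
    by (cases n) auto
  obtain t where t: "t \<le> 20"
    "loop_state b (length ns) (length xs + length (encode_node n))
      (xs @ encode_node (forget_node L n) @ concat (map encode_node ns)) (lit_table b L)
      ((step forget_program ^^ t) s)"
    using loop_body[of b "length ns" xs n "concat (map encode_node ns)" L s] Cons.prems by auto
  obtain u p where u: "u \<le> 20 * length ns"
    "loop_state b 0 p (xs @ concat (map encode_node (map (forget_node L) (n # ns))))
      (lit_table b L) ((step forget_program ^^ u) ((step forget_program ^^ t) s))"
    using Cons.IH[of "xs @ encode_node (forget_node L n)" "(step forget_program ^^ t) s"]
      t(2) Cons.prems(2) len by auto
  show ?case
    using t(1) u by (intro exI[of _ "u + t"]) (auto simp: funpow_add)
qed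

section \<open>Halting and total running time\<close>

lemma halted_funpow_step: "halted P s \<Longrightarrow> (step P ^^ t) s = s"
  by (induction t) (auto simp: step_def)

text \<open>A halted configuration is a fixed point of \<open>step\<close>; exact running times can
  thus be relaxed to bounds.\<close>

lemma outputs_within_mono:
  assumes "outputs_within P c L t d" "t \<le> u"
  shows "outputs_within P c L u d"
proof -
  have "(step P ^^ u) x = (step P ^^ (u - t)) ((step P ^^ t) x)" for x
    using assms(2) by (metis comp_apply funpow_add le_add_diff_inverse2)
  then show ?thesis
    using assms(1) by (simp add: outputs_within_def Let_def halted_funpow_step)
qed

lemma forget_program_outputs:
  "outputs_within forget_program c L (20 * length (nodes c) + 5) (forget L c)"
proof -
  let ?b = "length (encode c)" and ?n = "length (nodes c)"
  have "init_mem c L = list_mem (encode c) (lit_table ?b L)"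
    by (simp add: fun_eq_iff init_mem_def list_mem_def lit_table_def)
  moreover have enc: "encode c = [?n, root c] @ concat (map encode_node (nodes c))"
    by (simp add: encode_def)
  \<comment> \<open>Three instructions initialise the loop; the read pointer 2 skips the header,
    which is the initial prefix.\<close>
  ultimately have start: "loop_state ?b ?n (length [?n, root c])
      ([?n, root c] @ concat (map encode_node (nodes c))) (lit_table ?b L)
      ((step forget_program ^^ 3) (init_config c L))"
    by (simp add: loop_state_def init_config_def funpow_expand forget_program_step
      forget_program_nth list_mem_def del: One_nat_def)
  obtain t p where t: "t \<le> 20 * ?n"
    "loop_state ?b 0 p ([?n, root c] @ concat (map encode_node (map (forget_node L) (nodes c))))
      (lit_table ?b L) ((step forget_program ^^ t) ((step forget_program ^^ 3) (init_config c L)))"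
    using loop[OF start arg_cong[OF enc, of length]] by blast
  have enc_forget: "[?n, root c] @ concat (map encode_node (map (forget_node L) (nodes c))) =
      encode (forget L c)"
    by (simp add: encode_def forget_def)
  \<comment> \<open>Two jumps leave the loop for 25, the program length. Register 0 is still 0, so
    the output is the rewritten input.\<close>
  have "outputs_within forget_program c L (2 + (t + 3)) (forget L c)"
    using t(2) unfolding enc_forget outputs_within_def funpow_add
    by (simp add: loop_state_def funpow_expand forget_program_step forget_program_nth
      halted_def stores_circuit_def list_mem_def del: One_nat_def) (simp add: forget_program_def)
  then show ?thesis
    by (rule outputs_within_mono) (use t(1) in simp)
qed

theorem proposition26:
  "\<exists>(P :: program) (K :: nat). \<forall>(\<Delta> :: circuit) (ls :: literal list).
     sdd \<Delta> \<longrightarrow> distinct ls \<longrightarrow>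
     (\<exists>\<Gamma> :: circuit.
        outputs_within P \<Delta> (set ls) (K * circuit_size \<Delta>) \<Gamma> \<and>
        dnnf \<Gamma> \<and>
        equivalent (formula_of \<Gamma>) (exists_lits ls (formula_of \<Delta>)))"
proof (intro exI[of _ forget_program] exI[of _ 25] allI impI)
  fix \<Delta> :: circuit and ls :: "literal list"
  assume "sdd \<Delta>"
  then have dnnf: "dnnf \<Delta>" by (simp add: sdd_def dnnf_def)
  \<comment> \<open>The root is a node, so the additive 5 costs at most 5 per node, whence the
    factor 25.\<close>
  then have "1 \<le> length (nodes \<Delta>)" by (auto simp: dnnf_def nnf_circuit_def)
  then have "20 * length (nodes \<Delta>) + 5 \<le> 25 * circuit_size \<Delta>"
    unfolding circuit_size_def distrib_left by linarith
  then have "outputs_within forget_program \<Delta> (set ls) (25 * circuit_size \<Delta>) (forget (set ls) \<Delta>)"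
    by (rule outputs_within_mono[OF forget_program_outputs])
  then show "\<exists>\<Gamma>. outputs_within forget_program \<Delta> (set ls) (25 * circuit_size \<Delta>) \<Gamma> \<and>
      dnnf \<Gamma> \<and> equivalent (formula_of \<Gamma>) (exists_lits ls (formula_of \<Delta>))"
    using dnnf_forget[OF dnnf] equivalent_forget[OF dnnf] by blast
qed

end
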